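(* Let $\mu\in M(X)$ be a probability measure on a non-compact locally compact Cantor set $X$ and suppose $1 \notin G(S(\mu))$. Then for any compactification $cX$ of $X$ that is a Cantor set, the extension of $\mu$ to $cX$ by zero on $cX\setminus X$ is not good on $cX$.
   Context: A Cantor set is a non-empty zero-dimensional compact perfect metric space. A non-compact locally compact Cantor set is a non-compact locally compact metrizable space with no isolated points and with a countable basis of compact open sets. $M(X)$ is the set of Borel measures on $X$ that are full (every non-empty open set has positive measure) and non-atomic. The compact open values set is $S(\mu)=\{\mu(U): U \text{ compact open in } X,\ \mu(U)<\infty\}$, and $G(S(\mu))$ is the additive subgroup of $\mathbb{R}$ generated by $S(\mu)$. A full non-atomic finite Borel measure $\mu$ on a Cantor set $Z$ is good if for all compact open $U,V\subset Z$ with $\mu(U)<\mu(V)$ there is a compact open $W\subset V$ with $\mu(W)=\mu(U)$. A compactification $cX$ of $X$ is a compact space containing (a homeomorphic copy of) $X$ as a dense subset. *)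

theory Defs
  imports
    "HOL-Probability.Probability"
    "HOL-Computational_Algebra.Group_Closure"
begin

text \<open>Spaces are abstract topologies, so that the carrier of a space is an arbitrary set and
  not a whole type; \<^term>\<open>X dim_le 0\<close> is small inductive dimension, i.e. a base of clopen sets.\<close>

definition no_isolated_points :: "'a topology \<Rightarrow> bool" where
  "no_isolated_points X \<longleftrightarrow> (\<forall>x\<in>topspace X. \<not> openin X {x})"

definition Cantor_set :: "'a topology \<Rightarrow> bool" where
  "Cantor_set X \<longleftrightarrow>
     topspace X \<noteq> {} \<and> X dim_le 0 \<and> compact_space X \<and> no_isolated_points X \<and> metrizable_space X"

definition noncompact_locally_compact_Cantor_set :: "'a topology \<Rightarrow> bool" where
  "noncompact_locally_compact_Cantor_set X \<longleftrightarrow>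
     \<not> compact_space X \<and> locally_compact_space X \<and> metrizable_space X \<and> no_isolated_points X \<and>
     (\<exists>\<B>. countable \<B> \<and> (\<forall>V\<in>\<B>. openin X V \<and> compactin X V) \<and>
          (\<forall>U x. openin X U \<and> x \<in> U \<longrightarrow> (\<exists>V\<in>\<B>. x \<in> V \<and> V \<subseteq> U)))"

definition borel_of :: "'a topology \<Rightarrow> 'a measure" where
  "borel_of X = sigma (topspace X) {U. openin X U}"

definition full_measure :: "'a topology \<Rightarrow> 'a measure \<Rightarrow> bool" where
  "full_measure X \<mu> \<longleftrightarrow> (\<forall>U. openin X U \<and> U \<noteq> {} \<longrightarrow> emeasure \<mu> U > 0)"

definition non_atomic :: "'a measure \<Rightarrow> bool" where
  "non_atomic \<mu> \<longleftrightarrow>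
     (\<forall>A\<in>sets \<mu>. emeasure \<mu> A > 0 \<longrightarrow>
        (\<exists>B\<in>sets \<mu>. B \<subseteq> A \<and> 0 < emeasure \<mu> B \<and> emeasure \<mu> B < emeasure \<mu> A))"

text \<open>The set of measures called \<open>M(X)\<close>; being a Borel measure means that the
  \<open>\<sigma>\<close>-algebra of \<open>\<mu>\<close> is the Borel one.\<close>

definition full_nonatomic_borel :: "'a topology \<Rightarrow> 'a measure set" where
  "full_nonatomic_borel X = {\<mu>. sets \<mu> = sets (borel_of X) \<and> full_measure X \<mu> \<and> non_atomic \<mu>}"

definition compact_open_values :: "'a topology \<Rightarrow> 'a measure \<Rightarrow> real set" where
  "compact_open_values X \<mu> =
     {measure \<mu> U |U. openin X U \<and> compactin X U \<and> emeasure \<mu> U < \<infinity>}"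

text \<open>Goodness is a property of full non-atomic finite Borel measures on Cantor sets.
  These standing requirements are deliberately not conjuncts here, so that ``not good'' always
  means that the subset condition fails; \<open>zero_extension_admissible\<close> below shows that they hold
  for the extension by zero.\<close>

definition good_measure :: "'a topology \<Rightarrow> 'a measure \<Rightarrow> bool" where
  "good_measure Z \<mu> \<longleftrightarrow>
     (\<forall>U V. openin Z U \<and> compactin Z U \<and> openin Z V \<and> compactin Z V \<and> emeasure \<mu> U < emeasure \<mu> V \<longrightarrow>
        (\<exists>W. openin Z W \<and> compactin Z W \<and> W \<subseteq> V \<and> emeasure \<mu> W = emeasure \<mu> U))"

definition compactification :: "'a topology \<Rightarrow> 'b topology \<Rightarrow> ('a \<Rightarrow> 'b) \<Rightarrow> bool" where
  "compactification X cX e \<longleftrightarrow>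
     compact_space cX \<and> embedding_map X cX e \<and> cX closure_of (e ` topspace X) = topspace cX"

text \<open>With \<open>X\<close> identified with its copy \<open>e ` X\<close>, the extension by zero is
  \<open>B \<mapsto> \<mu> (B \<inter> X)\<close>, i.e. the image measure under \<open>e\<close>; see \<open>emeasure_zero_extension_image\<close>
  and \<open>emeasure_zero_extension_remainder\<close>.\<close>

definition zero_extension :: "'b topology \<Rightarrow> ('a \<Rightarrow> 'b) \<Rightarrow> 'a measure \<Rightarrow> 'b measure" where
  "zero_extension cX e \<mu> = distr \<mu> (borel_of cX) e"

lemma space_borel_of [simp]: "space (borel_of X) = topspace X"
  unfolding borel_of_def by (rule space_measure_of) (auto dest: openin_subset)

lemma sets_borel_of: "sets (borel_of X) = sigma_sets (topspace X) {U. openin X U}"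
  unfolding borel_of_def by (rule sets_measure_of) (auto dest: openin_subset)

lemma openin_borel_of: "openin X U \<Longrightarrow> U \<in> sets (borel_of X)"
  by (auto simp: sets_borel_of)

lemma continuous_map_borel_of:
  assumes "continuous_map X Y f"
  shows "f \<in> borel_of X \<rightarrow>\<^sub>M borel_of Y"
  unfolding borel_of_def[of Y]
proof (rule measurable_measure_of)
  show "{U. openin Y U} \<subseteq> Pow (topspace Y)"
    by (auto dest: openin_subset)
  show "f \<in> space (borel_of X) \<rightarrow> topspace Y"
    using assms by (auto simp: continuous_map_def)
  fix U assume "U \<in> {U. openin Y U}"
  then have "openin X {x \<in> topspace X. f x \<in> U}"
    using assms by (auto simp: continuous_map_def)
  moreover have "f -` U \<inter> space (borel_of X) = {x \<in> topspace X. f x \<in> U}"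
    by auto
  ultimately show "f -` U \<inter> space (borel_of X) \<in> sets (borel_of X)"
    by (simp add: openin_borel_of)
qed

context
  fixes X :: "'a topology" and cX :: "'b topology" and e :: "'a \<Rightarrow> 'b" and \<mu> :: "'a measure"
  assumes X: "noncompact_locally_compact_Cantor_set X"
    and cX: "Cantor_set cX" "compactification X cX e"
    and \<mu>: "\<mu> \<in> full_nonatomic_borel X" "prob_space \<mu>"
begin

private lemma emb: "embedding_map X cX e"
  and dense: "cX closure_of (e ` topspace X) = topspace cX"
  and sets_\<mu>: "sets \<mu> = sets (borel_of X)"
  using cX \<mu> by (auto simp: compactification_def full_nonatomic_borel_def)

private lemma space_\<mu>: "space \<mu> = topspace X"
  using sets_eq_imp_space_eq[OF sets_\<mu>] by simp

private lemma cont: "continuous_map X cX e"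
  using emb by (auto simp: embedding_map_def homeomorphic_eq_everything_map
      continuous_map_in_subtopology)

private lemma e_measurable: "e \<in> \<mu> \<rightarrow>\<^sub>M borel_of cX"
  using continuous_map_borel_of[OF cont] sets_\<mu>
  by (simp cong: measurable_cong_sets)

private lemma inj_e: "inj_on e (topspace X)"
  using emb by (simp add: embedding_map_def homeomorphic_map_def)

private lemma e_sub: "e ` topspace X \<subseteq> topspace cX"
  using cont by (auto simp: continuous_map_def)

private lemma openin_image: "openin cX (e ` topspace X)"
proof -
  have haus: "Hausdorff_space cX"
    using cX by (auto simp: Cantor_set_def metrizable_imp_Hausdorff_space)
  have "X homeomorphic_space subtopology cX (e ` topspace X)"
    using emb by (rule embedding_map_imp_homeomorphic_space)
  then have "locally_compact_space (subtopology cX (e ` topspace X))"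
    using X homeomorphic_locally_compact_space
    by (auto simp: noncompact_locally_compact_Cantor_set_def)
  then show ?thesis
    using locally_compact_subspace_openin_closure_of[OF haus e_sub] dense by simp
qed

private lemma image_borel: "e ` A \<in> sets (borel_of cX)" if "A \<in> sets \<mu>"
proof -
  have opn: "openin cX (e ` U)" if "openin X U" for U
  proof -
    have "open_map X (subtopology cX (e ` topspace X)) e"
      using emb unfolding embedding_map_def by (rule homeomorphic_imp_open_map)
    then have "openin (subtopology cX (e ` topspace X)) (e ` U)"
      using that by (simp add: open_map_def)
    then show ?thesis
      using openin_image by (rule openin_trans_full)
  qed
  have "A \<in> sigma_sets (topspace X) {U. openin X U}"
    using that by (simp add: sets_\<mu> sets_borel_of)
  then show ?thesis
  proof (induction rule: sigma_sets.induct)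
    case (Basic a)
    then show ?case by (simp add: opn openin_borel_of)
  next
    case Empty
    then show ?case by simp
  next
    case (Compl a)
    then have "a \<in> sets (borel_of X)"
      by (simp add: sets_borel_of)
    then have "a \<subseteq> topspace X"
      using sets.sets_into_space by force
    then have "e ` (topspace X - a) = e ` topspace X - e ` a"
      using inj_e by (simp add: inj_on_image_set_diff)
    then show ?case
      using sets.Diff[OF openin_borel_of[OF openin_image] Compl.IH] by simp
  next
    case (Union a)
    then show ?case by (simp add: image_UN)
  qed
qed

lemma emeasure_zero_extension:
  assumes "B \<in> sets (borel_of cX)"
  shows "emeasure (zero_extension cX e \<mu>) B = emeasure \<mu> (e -` B \<inter> topspace X)"
  using emeasure_distr[OF e_measurable assms] by (simp add: zero_extension_def space_\<mu>)

lemma emeasure_zero_extension_image: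
  assumes "A \<in> sets \<mu>"
  shows "emeasure (zero_extension cX e \<mu>) (e ` A) = emeasure \<mu> A"
proof -
  have "A \<subseteq> topspace X"
    using sets.sets_into_space[OF assms] by (simp add: space_\<mu>)
  then have "e -` (e ` A) \<inter> topspace X = A"
    using inj_e by (auto simp: inj_on_def)
  then show ?thesis
    using emeasure_zero_extension[OF image_borel[OF assms]] by simp
qed

lemma emeasure_zero_extension_remainder:
  "emeasure (zero_extension cX e \<mu>) (topspace cX - e ` topspace X) = 0"
proof -
  have "topspace cX - e ` topspace X \<in> sets (borel_of cX)"
    using sets.compl_sets[OF openin_borel_of[OF openin_image]] by simp
  moreover have "e -` (topspace cX - e ` topspace X) \<inter> topspace X = {}"
    by auto
  ultimately show ?thesis
    by (simp add: emeasure_zero_extension)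
qed

lemma zero_extension_admissible:
  "zero_extension cX e \<mu> \<in> full_nonatomic_borel cX" "prob_space (zero_extension cX e \<mu>)"
proof -
  let ?\<nu> = "zero_extension cX e \<mu>"
  have sets_\<nu>: "sets ?\<nu> = sets (borel_of cX)"
    by (simp add: zero_extension_def)
  have pre: "e -` B \<inter> topspace X \<in> sets \<mu>" if "B \<in> sets (borel_of cX)" for B
    using measurable_sets[OF e_measurable that] by (simp add: space_\<mu>)
  have "full_measure cX ?\<nu>"
    unfolding full_measure_def
  proof (intro allI impI, elim conjE)
    fix U assume U: "openin cX U" "U \<noteq> {}"
    have "openin X {x \<in> topspace X. e x \<in> U}"
      using cont U by (simp add: continuous_map_def)
    moreover have "e -` U \<inter> topspace X = {x \<in> topspace X. e x \<in> U}"
      by auto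
    moreover have "e -` U \<inter> topspace X \<noteq> {}"
    proof -
      obtain y where "y \<in> U" using U by auto
      then have "y \<in> cX closure_of (e ` topspace X)"
        using U dense openin_subset by blast
      then show ?thesis
        using U \<open>y \<in> U\<close> by (auto simp: in_closure_of)
    qed
    ultimately show "emeasure ?\<nu> U > 0"
      using \<mu> U by (auto simp: emeasure_zero_extension openin_borel_of full_nonatomic_borel_def
          full_measure_def)
  qed
  moreover have "non_atomic ?\<nu>"
    unfolding non_atomic_def sets_\<nu>
  proof (intro ballI impI)
    fix A assume A: "A \<in> sets (borel_of cX)" "emeasure ?\<nu> A > 0"
    let ?A = "e -` A \<inter> topspace X"
    have "non_atomic \<mu>"
      using \<mu> by (simp add: full_nonatomic_borel_def)
    then obtain B where B: "B \<in> sets \<mu>" "B \<subseteq> ?A" "0 < emeasure \<mu> B" "emeasure \<mu> B < emeasure \<mu> ?A"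
      using A pre[OF A(1)] emeasure_zero_extension[OF A(1)] unfolding non_atomic_def by auto
    have "emeasure ?\<nu> (e ` B) = emeasure \<mu> B" "emeasure ?\<nu> A = emeasure \<mu> ?A"
      using emeasure_zero_extension_image[OF B(1)] emeasure_zero_extension[OF A(1)] by auto
    moreover have "e ` B \<subseteq> A" "e ` B \<in> sets (borel_of cX)"
      using B image_borel by auto
    ultimately show "\<exists>B\<in>sets (borel_of cX). B \<subseteq> A \<and> 0 < emeasure ?\<nu> B \<and> emeasure ?\<nu> B < emeasure ?\<nu> A"
      using B by (intro bexI[of _ "e ` B"]) simp_all
  qed
  ultimately show "?\<nu> \<in> full_nonatomic_borel cX"
    by (simp add: full_nonatomic_borel_def sets_\<nu>)
  show "prob_space ?\<nu>"
    unfolding zero_extension_def using \<mu> e_measurable by (intro prob_space.prob_space_distr)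
qed

end

end

theory Submission
  imports Defs
begin

text \<open>Suppose the extension \<open>\<nu>\<close> is good and let \<open>V\<close> be a non-empty compact open subset of \<open>X\<close>.
  Then \<open>cX - V\<close> is clopen of measure \<open>1 - \<mu>(V) < 1\<close>. Since \<open>X\<close> is a countable union of
  compact open sets, some compact open \<open>K \<subseteq> X\<close> has larger measure, and goodness yields
  a clopen \<open>W \<subseteq> K\<close> of measure \<open>1 - \<mu>(V)\<close>. This \<open>W\<close> is compact open in \<open>X\<close>, so
  \<open>1 = \<mu>(V) + \<mu>(W)\<close> lies in \<open>G(S(\<mu>))\<close>.\<close>

text \<open>Finite unions of members of the countable compact open base increase to the whole space,
  so continuity of \<open>\<mu>\<close> from below yields one of measure above
  \<open>c\<close>.\<close>

lemma compact_open_measure_approximation: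
  assumes X: "noncompact_locally_compact_Cantor_set X"
    and sets: "sets \<mu> = sets (borel_of X)"
    and c: "c < emeasure \<mu> (topspace X)"
  shows "\<exists>K. openin X K \<and> compactin X K \<and> c < emeasure \<mu> K"
proof -
  obtain \<B> where \<B>: "countable \<B>" "\<And>V. V \<in> \<B> \<Longrightarrow> openin X V \<and> compactin X V"
      "\<And>U x. openin X U \<Longrightarrow> x \<in> U \<Longrightarrow> \<exists>V\<in>\<B>. x \<in> V \<and> V \<subseteq> U"
    using X unfolding noncompact_locally_compact_Cantor_set_def by metis
  \<comment> \<open>The empty set has measure 0, and no extended non-negative real lies below 0.
    With \<open>\<B>\<close> then non-empty, \<open>from_nat_into\<close> has range exactly
    \<open>\<B>\<close>, possibly with repetitions.\<close>
  have "topspace X \<noteq> {}"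
    using c by auto
  then have ne: "\<B> \<noteq> {}"
    using \<B>(3)[OF openin_topspace] by blast
  define K where "K n = (\<Union>i<n. from_nat_into \<B> i)" for n :: nat
  have K: "openin X (K n)" "compactin X (K n)" for n
    using \<B>(2) from_nat_into[OF ne] unfolding K_def by (auto intro!: compactin_Union)
  have "(\<Union>n. K n) = (\<Union>i. from_nat_into \<B> i)"
    unfolding K_def by auto
  also have "\<dots> = \<Union> \<B>"
    using range_from_nat_into[OF ne \<B>(1)] by auto
  also have "\<dots> = topspace X"
  proof
    show "\<Union> \<B> \<subseteq> topspace X"
      using \<B>(2) by (intro Union_least openin_subset) simp
    show "topspace X \<subseteq> \<Union> \<B>"
      using \<B>(3)[OF openin_topspace] by fast
  qed
  finally have "(\<Union>n. K n) = topspace X" .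
  moreover have "incseq K"
    unfolding K_def by (auto simp: incseq_def intro: less_le_trans)
  moreover have "range K \<subseteq> sets \<mu>"
    using K by (auto simp: sets openin_borel_of)
  ultimately have "(\<lambda>n. emeasure \<mu> (K n)) \<longlonglongrightarrow> emeasure \<mu> (topspace X)"
    using Lim_emeasure_incseq[of K \<mu>] by simp
  then have "\<forall>\<^sub>F n in sequentially. c < emeasure \<mu> (K n)"
    using c by (rule order_tendstoD)
  then obtain n where "c < emeasure \<mu> (K n)"
    using eventually_happens'[OF sequentially_bot] by blast
  then show ?thesis
    using K by blast
qed

theorem corollary3p8:
  fixes X :: "'a topology" and cX :: "'b topology" and e :: "'a \<Rightarrow> 'b" and \<mu> :: "'a measure"
  assumes "noncompact_locally_compact_Cantor_set X"
    and "\<mu> \<in> full_nonatomic_borel X"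
    and "prob_space \<mu>"
    and "1 \<notin> group_closure (compact_open_values X \<mu>)"
    and "compactification X cX e"
    and "Cantor_set cX"
  shows "\<not> good_measure cX (zero_extension cX e \<mu>)"
proof
  let ?\<nu> = "zero_extension cX e \<mu>"
  assume good: "good_measure cX ?\<nu>"
  interpret prob_space \<mu> by fact
  have sets: "sets \<mu> = sets (borel_of X)" and full: "full_measure X \<mu>"
    using assms(2) by (auto simp: full_nonatomic_borel_def)
  have space: "space \<mu> = topspace X"
    using sets_eq_imp_space_eq[OF sets] by simp
  have haus: "Hausdorff_space cX" and compact: "compact_space cX"
    using assms(6) by (auto simp: Cantor_set_def metrizable_imp_Hausdorff_space)
  have hom: "homeomorphic_map X (subtopology cX (e ` topspace X)) e"
    and dense: "cX closure_of (e ` topspace X) = topspace cX"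
    using assms(5) by (auto simp: compactification_def embedding_map_def)
  have cont: "continuous_map X cX e" and inj: "inj_on e (topspace X)"
    using hom by (auto simp: homeomorphic_eq_everything_map continuous_map_in_subtopology)
  have sub: "e ` topspace X \<subseteq> topspace cX"
    using cont by (auto simp: continuous_map_def)
  \<comment> \<open>Local compactness passes to the copy of \<open>X\<close>, and a dense locally
    compact subspace of a Hausdorff space is open.\<close>
  have "locally_compact_space (subtopology cX (e ` topspace X))"
    using assms(1) homeomorphic_locally_compact_space[OF homeomorphic_map_imp_homeomorphic_space[OF hom]]
    by (auto simp: noncompact_locally_compact_Cantor_set_def)
  then have "openin cX (e ` topspace X)"
    using locally_compact_subspace_openin_closure_of[OF haus sub] dense by simp
  then have open_image: "openin cX (e ` U)" if "openin X U" for U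
    using homeomorphic_imp_open_map[OF hom] that
    by (auto simp: open_map_def intro: openin_trans_full)
  have compact_image: "compactin cX (e ` U)" if "compactin X U" for U
    using that cont by (rule image_compactin)
  note emeasure_\<nu> = emeasure_zero_extension[OF assms(1,6,5,2,3)]
    and emeasure_\<nu>_image = emeasure_zero_extension_image[OF assms(1,6,5,2,3)]

  have "topspace X \<noteq> {}"
    using not_empty space by simp
  then obtain V where V: "openin X V" "compactin X V" "V \<noteq> {}"
    using assms(1) openin_topspace[of X] unfolding noncompact_locally_compact_Cantor_set_def
    by blast
  have V_pos: "emeasure \<mu> V > 0"
    using full V by (simp add: full_measure_def)
  have V_sets: "V \<in> sets \<mu>"
    using V by (simp add: sets openin_borel_of)
  define C where "C = topspace cX - e ` V"
  \<comment> \<open>Closed since the image of \<open>V\<close> is open; open since that image is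
    compact in a Hausdorff space, hence closed.\<close>
  have "closedin cX C"
    unfolding C_def using open_image[OF V(1)] by blast
  then have C: "openin cX C" "compactin cX C"
    using compactin_imp_closedin[OF haus compact_image[OF V(2)]] closedin_compact_space[OF compact]
    by (auto simp: C_def)
  have "e -` C \<inter> topspace X = space \<mu> - V"
    using inj_onD[OF inj] sub openin_subset[OF V(1)] unfolding C_def space by blast
  then have \<nu>_C: "emeasure ?\<nu> C = emeasure \<mu> (space \<mu> - V)"
    using emeasure_\<nu>[OF openin_borel_of[OF C(1)]] by simp
  \<comment> \<open>Strictness comes from fullness: the non-empty open set \<open>V\<close> has
    positive measure.\<close>
  have "emeasure \<mu> (space \<mu> - V) < emeasure \<mu> (topspace X)"
    using V_pos prob_compl[OF V_sets] emeasure_space_1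
    by (simp add: emeasure_eq_measure space ennreal_lessI flip: ennreal_1)
  then obtain K where K: "openin X K" "compactin X K" "emeasure \<mu> (space \<mu> - V) < emeasure \<mu> K"
    using compact_open_measure_approximation[OF assms(1) sets] by blast
  have "emeasure ?\<nu> (e ` K) = emeasure \<mu> K"
    using K by (intro emeasure_\<nu>_image) (simp add: sets openin_borel_of)
  \<comment> \<open>Goodness trades \<open>C\<close>, which contains the whole remainder, for a
    clopen \<open>W\<close> of equal measure inside the copy of \<open>X\<close>.\<close>
  then obtain W where W: "openin cX W" "compactin cX W" "W \<subseteq> e ` K" "emeasure ?\<nu> W = emeasure ?\<nu> C"
    using good C open_image[OF K(1)] compact_image[OF K(2)] K(3) \<nu>_C
    unfolding good_measure_def by metis
  define W' where "W' = {x \<in> topspace X. e x \<in> W}"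
  have W'_open: "openin X W'"
    unfolding W'_def using cont W(1) by (rule openin_continuous_map_preimage)
  have W_sub: "W \<subseteq> e ` topspace X"
    using W(3) openin_subset[OF K(1)] by blast
  then have "e ` W' = W"
    by (auto simp: W'_def)
  \<comment> \<open>Compactness pulls back along the homeomorphism onto the image because
    \<open>W\<close> avoids the remainder.\<close>
  then have W'_compact: "compactin X W'"
    using homeomorphic_map_compactness_eq[OF hom, of W'] W(2) W_sub
    by (auto simp: W'_def compactin_subtopology)
  have "e -` W \<inter> topspace X = W'"
    by (auto simp: W'_def)
  then have "measure \<mu> W' = measure \<mu> (space \<mu> - V)"
    using emeasure_\<nu>[OF openin_borel_of[OF W(1)]] W(4) \<nu>_C by (simp add: measure_def)
  then have sum: "measure \<mu> V + measure \<mu> W' = 1"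
    using prob_compl[OF V_sets] by simp
  \<comment> \<open>The finiteness required of a value is automatic for a probability
    measure.\<close>
  have "measure \<mu> V \<in> compact_open_values X \<mu>" "measure \<mu> W' \<in> compact_open_values X \<mu>"
    using V W'_open W'_compact by (auto simp: compact_open_values_def emeasure_eq_measure)
  then have "measure \<mu> V + measure \<mu> W' \<in> group_closure (compact_open_values X \<mu>)"
    by (intro group_closure_add group_closure.base insertI2)
  with sum assms(4) show False
    by simp
qed

end
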